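(* Consider one coarse time-step, from $t^n$ to $t^{n+1}=t^n+\Delta t$, of the FB-LTS scheme (defined in the context, with an arbitrary positive integer $M$ and FB-weights $\beta_1,\beta_2,\beta_3$) applied to the TRiSK spatial discretization of the shallow water equations, in which the thickness tendency is $$\Psi_i(\mathbf{u},\mathbf{h})=\frac{-1}{A_i}\sum_{e\in\mathcal{E}_i} n_{e,i}\,\ell_e\,F_e(u_e,\mathbf{h}),\qquad i\in\Omega_P .$$ Assume either that there are no boundary conditions (the domain has no boundary, so every edge is shared by exactly two primal cells) or that no-flow boundary conditions hold (the normal velocity, and hence the thickness flux $F_e$, is zero at every boundary edge). Then FB-LTS exactly preserves the discrete representation of mass: the globally integrated thickness is constant in time, i.e. $$\sum_{i\in\Omega_P} A_i\,h_i^{n+1}=\sum_{i\in\Omega_P} A_i\,h_i^{n}.$$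
   Context: **Equations and mesh.** The shallow water equations are $\partial_t \mathbf{u}+(\nabla\times\mathbf{u}+f\mathbf{k})\times\mathbf{u}=-\nabla\frac{|\mathbf{u}|^2}{2}-g\nabla(h+z_b)$, $\partial_t h+\nabla\cdot(h\mathbf{u})=0$ ($\mathbf u$ horizontal velocity, $h$ thickness, $f$ Coriolis parameter, $\mathbf k$ local vertical unit vector, $g$ gravitational constant, $z_b$ bottom height). TRiSK is a C-grid finite-volume discretization on a polygonal mesh with finite set of primal cells $\Omega_P$ and set of cell edges $\Omega_E$. The unknowns are $\mathbf{h}=(h_i)_{i\in\Omega_P}$ (thickness at cell centers) and $\mathbf{u}=(u_e)_{e\in\Omega_E}$ (component of velocity along a fixed unit normal $\mathbf{n}_e$ of edge $e$). The semi-discrete system is $\partial_t u_e=\Phi_e(\mathbf{u},\mathbf{h})$, $\partial_t h_i=\Psi_i(\mathbf{u},\mathbf{h})$, where $\Phi_e$ is the discretized momentum tendency and $\Psi_i$ is the thickness tendency in the claim. There, $A_i$ is the area of cell $i$, $\mathcal{E}_i$ the set of edges of cell $i$, $\ell_e$ the length of edge $e$, $n_{e,i}\in\{1,-1\}$ is such that $n_{e,i}\mathbf{n}_e$ is the outward unit normal to cell $i$ at $e$ (so $n_{e,i}=-n_{e,j}$ if $e$ is shared by cells $i\ne j$), and $F_e=F_e(u_e,\mathbf{h})$ is the signed thickness flux at $e$ in direction $\mathbf{n}_e$; it depends only on $u_e$ and on the thicknesses in the cells adjacent to $e$. **LTS regions.** $\Omega_P=\mathcal{F}_P\cup\mathcal{C}_P$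 (fine and coarse cells, disjoint), and $\mathcal{C}_P$ is the disjoint union of $\mathcal{C}_P^{\text{IF-1}}$ (interface one), $\mathcal{C}_P^{\text{IF-2}}$ (interface two) and $\mathcal{C}_P^{\text{int}}$ (interior coarse). In the ordering fine, IF-1, IF-2, int, only consecutive regions border each other. Edges are partitioned correspondingly into $\mathcal{F}_E,\mathcal{C}_E^{\text{IF-1}},\mathcal{C}_E^{\text{IF-2}},\mathcal{C}_E^{\text{int}}$; an edge shared by cells of two different regions belongs to the region closest to the fine region. With $r$ the stencil radius of the tendency operators, $\mathcal{F}_P^\ell\subseteq\mathcal{F}_P$ ($\ell=1,\dots,5$) consists of the $\ell r$ layers of fine cells neighboring $\mathcal{C}_P$, and $\mathcal{F}_E^\ell$ is the corresponding set of edges. It is assumed that there are enough layers of interface cells that the stencils of the tendencies in any region contain no cells more than one region away. **FB-LTS scheme.** Given $(\mathbf{u}^n,\mathbf{h}^n)$, a step proceeds as follows (data denoted by a tilde is "uncorrected"). 1. *Coarse advancement.* At the boundary between IF-2 and int, tilde and bar data are identified: in formulas with tilde arguments, tilde data on $\mathcal{C}^{\text{int}}$ means the bar data, and in formulas with bar arguments, bar data on $\mathcal{C}^{\text{IF-2}}$ means the tilde data. - For $i\in\mathcal{F}_P^5\cup\mathcal{C}_P^{\text{IF-1}}\cup\mathcal{C}_P^{\text{IF-2}}$: $\tilde h_i^{n+1/3}=h_i^n+\frac{\Delta t}{3}\Psi_i(\mathbf{u}^n,\mathbf{h}^n)$, $h_i^*=\beta_1\tilde h_i^{n+1/3}+(1-\beta_1)h_i^n$.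 For $i\in\mathcal{C}_P^{\text{int}}$: the same formulas with $\bar h_i^{n+1/3}$ in place of $\tilde h_i^{n+1/3}$. - $\tilde u_e^{n+1/3}=u_e^n+\frac{\Delta t}{3}\Phi_e(\mathbf{u}^n,\mathbf{h}^* )$ for $e\in\mathcal{F}_E^4\cup\mathcal{C}_E^{\text{IF-1}}\cup\mathcal{C}_E^{\text{IF-2}}$; $\bar u_e^{n+1/3}$ is given by the same formula for $e\in\mathcal{C}_E^{\text{int}}$. - For $i\in\mathcal{F}_P^3\cup\mathcal{C}_P^{\text{IF-1}}\cup\mathcal{C}_P^{\text{IF-2}}$: $\tilde h_i^{n+1/2}=h_i^n+\frac{\Delta t}{2}\Psi_i(\tilde{\mathbf{u}}^{n+1/3},\tilde{\mathbf{h}}^{n+1/3})$, $h_i^{**}=\beta_2\tilde h_i^{n+1/2}+(1-\beta_2)h_i^n$. For $i\in\mathcal{C}_P^{\text{int}}$: the same with bars in place of tildes. - $\tilde u_e^{n+1/2}=u_e^n+\frac{\Delta t}{2}\Phi_e(\tilde{\mathbf{u}}^{n+1/3},\mathbf{h}^{**})$ for $e\in\mathcal{F}_E^2\cup\mathcal{C}_E^{\text{IF-1}}\cup\mathcal{C}_E^{\text{IF-2}}$; $\bar u_e^{n+1/2}=u_e^n+\frac{\Delta t}{2}\Phi_e(\bar{\mathbf{u}}^{n+1/3},\mathbf{h}^{**})$ for $e\in\mathcal{C}_E^{\text{int}}$. - For $i\in\mathcal{F}_P^1\cup\mathcal{C}_P^{\text{IF-1}}\cup\mathcal{C}_P^{\text{IF-2}}$: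 $\tilde h_i^{n+1}=h_i^n+\Delta t\,\Psi_i(\tilde{\mathbf{u}}^{n+1/2},\tilde{\mathbf{h}}^{n+1/2})$, $h_i^{***}=\beta_3\tilde h_i^{n+1}+(1-2\beta_3)\tilde h_i^{n+1/2}+\beta_3h_i^n$. For $i\in\mathcal{C}_P^{\text{int}}$: $h_i^{n+1}=h_i^n+\Delta t\,\Psi_i(\bar{\mathbf{u}}^{n+1/2},\bar{\mathbf{h}}^{n+1/2})$, $h_i^{***}=\beta_3h_i^{n+1}+(1-2\beta_3)\bar h_i^{n+1/2}+\beta_3h_i^n$. - $\tilde u_e^{n+1}=u_e^n+\Delta t\,\Phi_e(\tilde{\mathbf{u}}^{n+1/2},\mathbf{h}^{***})$ for $e\in\mathcal{C}_E^{\text{IF-1}}$; $u_e^{n+1}=u_e^n+\Delta t\,\Phi_e(\bar{\mathbf{u}}^{n+1/2},\mathbf{h}^{***})$ for $e\in\mathcal{C}_E^{\text{int}}$. 2. *Interface prediction.* On $\mathcal{C}_P^{\text{IF-1}}$ and $\mathcal{C}_E^{\text{IF-1}}$, for $y=h_i$ or $y=u_e$ and $k=0,\dots,M-1$: $y^{n,k}=\frac kM\tilde y^{n+1}+(1-\frac kM)y^n$ (also for $k=M$ for $h$), $\bar y^{n,k+1/3}=\frac kM\tilde y^{n+1}+\frac1M\tilde y^{n+1/3}+(1-\frac{k+1}M)y^n$, $\bar y^{n,k+1/2}=\frac kM\tilde y^{n+1}+\frac1M\tilde y^{n+1/2}+(1-\frac{k+1}M)y^n$. For $i\in\mathcal{C}_P^{\text{IF-1}}$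 also $h_i^{*,k}=\beta_1\bar h_i^{n,k+1/3}+(1-\beta_1)h_i^{n,k}$, $h_i^{**,k}=\beta_2\bar h_i^{n,k+1/2}+(1-\beta_2)h_i^{n,k}$, $h_i^{***,k}=\beta_3h_i^{n,k+1}+(1-2\beta_3)\bar h_i^{n,k+1/2}+\beta_3h_i^{n,k}$. 3. *Fine advancement.* For $i\in\mathcal{F}_P$, $e\in\mathcal{F}_E$, start from $h_i^{n,0}=h_i^n$, $u_e^{n,0}=u_e^n$, and for $k=0,\dots,M-1$ compute (using predicted data on IF-1 where needed) $\bar h_i^{n,k+1/3}=h_i^{n,k}+\frac{\Delta t}{3M}\Psi_i(\mathbf{u}^{n,k},\mathbf{h}^{n,k})$, $h_i^{*,k}=\beta_1\bar h_i^{n,k+1/3}+(1-\beta_1)h_i^{n,k}$, $\bar u_e^{n,k+1/3}=u_e^{n,k}+\frac{\Delta t}{3M}\Phi_e(\mathbf{u}^{n,k},\mathbf{h}^{*,k})$; $\bar h_i^{n,k+1/2}=h_i^{n,k}+\frac{\Delta t}{2M}\Psi_i(\bar{\mathbf{u}}^{n,k+1/3},\bar{\mathbf{h}}^{n,k+1/3})$, $h_i^{**,k}=\beta_2\bar h_i^{n,k+1/2}+(1-\beta_2)h_i^{n,k}$, $\bar u_e^{n,k+1/2}=u_e^{n,k}+\frac{\Delta t}{2M}\Phi_e(\bar{\mathbf{u}}^{n,k+1/3},\mathbf{h}^{**,k})$; $h_i^{n,k+1}=h_i^{n,k}+\frac{\Delta t}{M}\Psi_i(\bar{\mathbf{u}}^{n,k+1/2},\bar{\mathbf{h}}^{n,k+1/2})$,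 $h_i^{***,k}=\beta_3h_i^{n,k+1}+(1-2\beta_3)\bar h_i^{n,k+1/2}+\beta_3h_i^{n,k}$, $u_e^{n,k+1}=u_e^{n,k}+\frac{\Delta t}{M}\Phi_e(\bar{\mathbf{u}}^{n,k+1/2},\mathbf{h}^{***,k})$. Then set $h_i^{n+1}:=h_i^{n,M}$, $u_e^{n+1}:=u_e^{n,M}$. 4. *Interface correction.* For $i\in\mathcal{C}_P^{\text{IF-1}}\cup\mathcal{C}_P^{\text{IF-2}}$, $e\in\mathcal{C}_E^{\text{IF-1}}\cup\mathcal{C}_E^{\text{IF-2}}$: $h_i^{n+1}=h_i^n+\frac{\Delta t}{M}\sum_{k=0}^{M-1}\Psi_i(\bar{\mathbf{u}}^{n,k+1/2},\bar{\mathbf{h}}^{n,k+1/2})$, $u_e^{n+1}=u_e^n+\frac{\Delta t}{M}\sum_{k=0}^{M-1}\Phi_e(\bar{\mathbf{u}}^{n,k+1/2},\mathbf{h}^{***,k})$, where for every $k$, on $\mathcal{C}^{\text{IF-2}}$ one sets $\bar u_e^{n,k+1/2}:=\tilde u_e^{n+1/2}$, $\bar h_i^{n,k+1/2}:=\tilde h_i^{n+1/2}$, $h_i^{***,k}:=h_i^{***}$, and on $\mathcal{C}^{\text{int}}$ one sets $\bar u_e^{n,k+1/2}:=\bar u_e^{n+1/2}$, $\bar h_i^{n,k+1/2}:=\bar h_i^{n+1/2}$, $h_i^{***,k}:=h_i^{***}$. On IF-1 the predicted data, and on the fine region the fine-advancement data, are used. *)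

theory Defs
  imports Complex_Main
begin

section \<open>Polygonal C-grid meshes\<close>

text \<open>
  \<open>orient G e i\<close> is the sign \<open>n_{e,i}\<close> for which \<open>n_{e,i} n_e\<close> is the outward unit
  normal of cell \<open>i\<close> at its edge \<open>e\<close>.  It is only meaningful when \<open>e \<in> cell_edges G i\<close>.
\<close>

record ('c, 'e) mesh =
  cells :: "'c set"
  edges :: "'e set"
  cell_edges :: "'c \<Rightarrow> 'e set"
  area :: "'c \<Rightarrow> real"
  len :: "'e \<Rightarrow> real"
  orient :: "'e \<Rightarrow> 'c \<Rightarrow> real"

definition edge_cells :: "('c, 'e) mesh \<Rightarrow> 'e \<Rightarrow> 'c set" where
  "edge_cells G e = {i \<in> cells G. e \<in> cell_edges G i}"

definition wf_mesh :: "('c, 'e) mesh \<Rightarrow> bool" where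
  "wf_mesh G \<longleftrightarrow>
     finite (cells G) \<and> finite (edges G) \<and>
     (\<forall>i\<in>cells G. cell_edges G i \<subseteq> edges G) \<and>
     (\<forall>e\<in>edges G. card (edge_cells G e) = 1 \<or> card (edge_cells G e) = 2) \<and>
     (\<forall>i\<in>cells G. 0 < area G i) \<and>
     (\<forall>e\<in>edges G. 0 < len G e) \<and>
     (\<forall>i\<in>cells G. \<forall>e\<in>cell_edges G i. orient G e i = 1 \<or> orient G e i = -1) \<and>
     (\<forall>e\<in>edges G. \<forall>i\<in>edge_cells G e. \<forall>j\<in>edge_cells G e.
        i \<noteq> j \<longrightarrow> orient G e i = - orient G e j)"

definition boundary_edges :: "('c, 'e) mesh \<Rightarrow> 'e set" where
  "boundary_edges G = {e \<in> edges G. card (edge_cells G e) = 1}"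

definition no_boundary :: "('c, 'e) mesh \<Rightarrow> bool" where
  "no_boundary G \<longleftrightarrow> (\<forall>e\<in>edges G. card (edge_cells G e) = 2)"

text \<open>\<open>cell_nbhd G S k\<close> is \<open>S\<close> together with \<open>k\<close> layers of neighbouring cells.\<close>

primrec cell_nbhd :: "('c, 'e) mesh \<Rightarrow> 'c set \<Rightarrow> nat \<Rightarrow> 'c set" where
  "cell_nbhd G S 0 = S"
| "cell_nbhd G S (Suc k) = cell_nbhd G S k \<union>
     {j \<in> cells G. \<exists>i\<in>cell_nbhd G S k. cell_edges G i \<inter> cell_edges G j \<noteq> {}}"


section \<open>Spatial discretization\<close>

text \<open>
  \<open>F e v h\<close> is the thickness flux through \<open>e\<close> in the direction of the fixed normal of \<open>e\<close>
  when the normal velocity at \<open>e\<close> is \<open>v\<close>.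
\<close>

definition local_flux :: "('c, 'e) mesh \<Rightarrow> ('e \<Rightarrow> real \<Rightarrow> ('c \<Rightarrow> real) \<Rightarrow> real) \<Rightarrow> bool" where
  "local_flux G F \<longleftrightarrow>
     (\<forall>e\<in>edges G. \<forall>v h h'. (\<forall>i\<in>edge_cells G e. h i = h' i) \<longrightarrow> F e v h = F e v h')"

definition thickness_tendency ::
  "('c, 'e) mesh \<Rightarrow> ('e \<Rightarrow> real \<Rightarrow> ('c \<Rightarrow> real) \<Rightarrow> real) \<Rightarrow>
   'c \<Rightarrow> ('e \<Rightarrow> real) \<Rightarrow> ('c \<Rightarrow> real) \<Rightarrow> real" where
  "thickness_tendency G F i u h =
     (-1 / area G i) * (\<Sum>e\<in>cell_edges G i. orient G e i * len G e * F e (u e) h)"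


section \<open>Local time-stepping regions\<close>

datatype region = Fine | IF1 | IF2 | Interior

primrec rank :: "region \<Rightarrow> nat" where
  "rank Fine = 0"
| "rank IF1 = 1"
| "rank IF2 = 2"
| "rank Interior = 3"

definition within_one :: "region \<Rightarrow> region \<Rightarrow> bool" where
  "within_one R S \<longleftrightarrow> rank R \<le> rank S + 1 \<and> rank S \<le> rank R + 1"

text \<open>
  \<open>stencil L e\<close> is the set of cells in the stencil of the momentum tendency at \<open>e\<close>; this
  tendency may use the thickness in these cells and the velocities on their edges.  The
  stencil of the thickness tendency in a cell \<open>i\<close> is fixed by the flux form: it consists of
  \<open>i\<close> and the cells sharing an edge with \<open>i\<close>.
\<close>

record ('c, 'e) lts =
  region :: "'c \<Rightarrow> region"
  radius :: nat
  stencil :: "'e \<Rightarrow> 'c set"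

definition reg_cells :: "('c, 'e) mesh \<Rightarrow> ('c, 'e) lts \<Rightarrow> region \<Rightarrow> 'c set" where
  "reg_cells G L R = {i \<in> cells G. region L i = R}"

text \<open>An edge belongs to the region closest to the fine one among those of its cells.\<close>

definition reg_edges :: "('c, 'e) mesh \<Rightarrow> ('c, 'e) lts \<Rightarrow> region \<Rightarrow> 'e set" where
  "reg_edges G L R = {e \<in> edges G.
     (\<exists>i\<in>edge_cells G e. region L i = R) \<and>
     (\<forall>i\<in>edge_cells G e. rank R \<le> rank (region L i))}"

definition coarse_cells :: "('c, 'e) mesh \<Rightarrow> ('c, 'e) lts \<Rightarrow> 'c set" where
  "coarse_cells G L = reg_cells G L IF1 \<union> reg_cells G L IF2 \<union> reg_cells G L Interior"

definition fine_layer_cells :: "('c, 'e) mesh \<Rightarrow> ('c, 'e) lts \<Rightarrow> nat \<Rightarrow> 'c set" where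
  "fine_layer_cells G L l =
     reg_cells G L Fine \<inter> cell_nbhd G (coarse_cells G L) (l * radius L)"

definition fine_layer_edges :: "('c, 'e) mesh \<Rightarrow> ('c, 'e) lts \<Rightarrow> nat \<Rightarrow> 'e set" where
  "fine_layer_edges G L l = (\<Union>i\<in>fine_layer_cells G L l. cell_edges G i)"

definition local_momentum ::
  "('c, 'e) mesh \<Rightarrow> ('c, 'e) lts \<Rightarrow>
   ('e \<Rightarrow> ('e \<Rightarrow> real) \<Rightarrow> ('c \<Rightarrow> real) \<Rightarrow> real) \<Rightarrow> bool" where
  "local_momentum G L \<Phi> \<longleftrightarrow>
     (\<forall>e\<in>edges G. \<forall>u u' h h'.
        (\<forall>i\<in>stencil L e. h i = h' i) \<and>
        (\<forall>i\<in>stencil L e. \<forall>a\<in>cell_edges G i. u a = u' a)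
        \<longrightarrow> \<Phi> e u h = \<Phi> e u' h')"

text \<open>
  The second conjunct from the end is the bordering condition for regions; it also says that
  the stencil of the thickness tendency reaches at most one region away.
\<close>

definition wf_lts :: "('c, 'e) mesh \<Rightarrow> ('c, 'e) lts \<Rightarrow> bool" where
  "wf_lts G L \<longleftrightarrow>
     1 \<le> radius L \<and>
     (\<forall>e\<in>edges G. stencil L e \<subseteq> cells G) \<and>
     (\<forall>i\<in>cells G. \<forall>e\<in>cell_edges G i. stencil L e \<subseteq> cell_nbhd G {i} (radius L)) \<and>
     (\<forall>i\<in>cells G. \<forall>j\<in>cells G. cell_edges G i \<inter> cell_edges G j \<noteq> {} \<longrightarrow>
        within_one (region L i) (region L j)) \<and>
     (\<forall>R. \<forall>e\<in>reg_edges G L R. \<forall>j\<in>stencil L e. within_one R (region L j))"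


section \<open>One step of the FB-LTS scheme\<close>

text \<open>
  All quantities of a coarse step from \<open>n\<close> to \<open>n + 1\<close>.  A quantity is constrained
  only on the cells or edges where the scheme computes it; its other values are arbitrary.

  Without a \<open>k\<close> in the name (coarse advancement): \<open>h13\<close>, \<open>u13\<close>, \<open>h12\<close>, \<open>u12\<close> hold the
  stages \<open>n + 1/3\<close> and \<open>n + 1/2\<close>, namely the tilde data on the fine layers and on both
  interface regions and the bar data on the interior coarse region.  Keeping the two in one
  field is the identification of tilde and bar data across the border between \<open>IF2\<close> and
  \<open>Interior\<close>.  \<open>ht1\<close>, \<open>ut1\<close> are the uncorrected (tilde) values at \<open>n + 1\<close>, and \<open>hs\<close>, \<open>hss\<close>,
  \<open>hsss\<close> are the forward-backward averages with one, two and three stars.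

  With a \<open>k\<close>: \<open>hk k\<close>, \<open>uk k\<close> are the values at the substep \<open>(n, k)\<close>; \<open>hk13 k\<close>, \<open>uk13 k\<close>,
  \<open>hk12 k\<close>, \<open>uk12 k\<close> are the bar values at \<open>(n, k + 1/3)\<close> and \<open>(n, k + 1/2)\<close>; \<open>hks k\<close>,
  \<open>hkss k\<close>, \<open>hksss k\<close> are the starred averages in substep \<open>k\<close>.
\<close>

record ('c, 'e) step_data =
  hn :: "'c \<Rightarrow> real"
  un :: "'e \<Rightarrow> real"
  h13 :: "'c \<Rightarrow> real"
  hs :: "'c \<Rightarrow> real"
  u13 :: "'e \<Rightarrow> real"
  h12 :: "'c \<Rightarrow> real"
  hss :: "'c \<Rightarrow> real"
  u12 :: "'e \<Rightarrow> real"
  ht1 :: "'c \<Rightarrow> real"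
  hsss :: "'c \<Rightarrow> real"
  ut1 :: "'e \<Rightarrow> real"
  hk :: "nat \<Rightarrow> 'c \<Rightarrow> real"
  uk :: "nat \<Rightarrow> 'e \<Rightarrow> real"
  hk13 :: "nat \<Rightarrow> 'c \<Rightarrow> real"
  hks :: "nat \<Rightarrow> 'c \<Rightarrow> real"
  uk13 :: "nat \<Rightarrow> 'e \<Rightarrow> real"
  hk12 :: "nat \<Rightarrow> 'c \<Rightarrow> real"
  hkss :: "nat \<Rightarrow> 'c \<Rightarrow> real"
  uk12 :: "nat \<Rightarrow> 'e \<Rightarrow> real"
  hksss :: "nat \<Rightarrow> 'c \<Rightarrow> real"
  hnew :: "'c \<Rightarrow> real"
  unew :: "'e \<Rightarrow> real"

type_synonym ('x, 'c, 'e) tendency = "'x \<Rightarrow> ('e \<Rightarrow> real) \<Rightarrow> ('c \<Rightarrow> real) \<Rightarrow> real"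

definition coarse_stage_cells :: "('c, 'e) mesh \<Rightarrow> ('c, 'e) lts \<Rightarrow> nat \<Rightarrow> 'c set" where
  "coarse_stage_cells G L l = fine_layer_cells G L l \<union> coarse_cells G L"

definition coarse_stage_edges :: "('c, 'e) mesh \<Rightarrow> ('c, 'e) lts \<Rightarrow> nat \<Rightarrow> 'e set" where
  "coarse_stage_edges G L l = fine_layer_edges G L l \<union>
     reg_edges G L IF1 \<union> reg_edges G L IF2 \<union> reg_edges G L Interior"

definition coarse_advancement ::
  "('c, 'e) mesh \<Rightarrow> ('c, 'e) lts \<Rightarrow> ('e, 'c, 'e) tendency \<Rightarrow> ('c, 'c, 'e) tendency \<Rightarrow>
   real \<Rightarrow> real \<Rightarrow> real \<Rightarrow> real \<Rightarrow> ('c, 'e) step_data \<Rightarrow> bool" where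
  "coarse_advancement G L \<Phi> \<Psi> dt \<beta>1 \<beta>2 \<beta>3 D \<longleftrightarrow>
     (\<forall>i\<in>coarse_stage_cells G L 5.
        h13 D i = hn D i + dt / 3 * \<Psi> i (un D) (hn D) \<and>
        hs D i = \<beta>1 * h13 D i + (1 - \<beta>1) * hn D i) \<and>
     (\<forall>e\<in>coarse_stage_edges G L 4.
        u13 D e = un D e + dt / 3 * \<Phi> e (un D) (hs D)) \<and>
     (\<forall>i\<in>coarse_stage_cells G L 3.
        h12 D i = hn D i + dt / 2 * \<Psi> i (u13 D) (h13 D) \<and>
        hss D i = \<beta>2 * h12 D i + (1 - \<beta>2) * hn D i) \<and>
     (\<forall>e\<in>coarse_stage_edges G L 2.
        u12 D e = un D e + dt / 2 * \<Phi> e (u13 D) (hss D)) \<and>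
     (\<forall>i\<in>fine_layer_cells G L 1 \<union> reg_cells G L IF1 \<union> reg_cells G L IF2.
        ht1 D i = hn D i + dt * \<Psi> i (u12 D) (h12 D) \<and>
        hsss D i = \<beta>3 * ht1 D i + (1 - 2 * \<beta>3) * h12 D i + \<beta>3 * hn D i) \<and>
     (\<forall>i\<in>reg_cells G L Interior.
        hnew D i = hn D i + dt * \<Psi> i (u12 D) (h12 D) \<and>
        hsss D i = \<beta>3 * hnew D i + (1 - 2 * \<beta>3) * h12 D i + \<beta>3 * hn D i) \<and>
     (\<forall>e\<in>reg_edges G L IF1. ut1 D e = un D e + dt * \<Phi> e (u12 D) (hsss D)) \<and>
     (\<forall>e\<in>reg_edges G L Interior. unew D e = un D e + dt * \<Phi> e (u12 D) (hsss D))"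

definition interface_prediction ::
  "('c, 'e) mesh \<Rightarrow> ('c, 'e) lts \<Rightarrow> nat \<Rightarrow> real \<Rightarrow> real \<Rightarrow> real \<Rightarrow>
   ('c, 'e) step_data \<Rightarrow> bool" where
  "interface_prediction G L M \<beta>1 \<beta>2 \<beta>3 D \<longleftrightarrow>
     (\<forall>i\<in>reg_cells G L IF1. \<forall>k\<le>M.
        hk D k i = real k / real M * ht1 D i + (1 - real k / real M) * hn D i) \<and>
     (\<forall>i\<in>reg_cells G L IF1. \<forall>k<M.
        hk13 D k i = real k / real M * ht1 D i + 1 / real M * h13 D i
                     + (1 - real (k + 1) / real M) * hn D i \<and>
        hk12 D k i = real k / real M * ht1 D i + 1 / real M * h12 D i
                     + (1 - real (k + 1) / real M) * hn D i \<and>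
        hks D k i = \<beta>1 * hk13 D k i + (1 - \<beta>1) * hk D k i \<and>
        hkss D k i = \<beta>2 * hk12 D k i + (1 - \<beta>2) * hk D k i \<and>
        hksss D k i = \<beta>3 * hk D (k + 1) i + (1 - 2 * \<beta>3) * hk12 D k i + \<beta>3 * hk D k i) \<and>
     (\<forall>e\<in>reg_edges G L IF1. \<forall>k<M.
        uk D k e = real k / real M * ut1 D e + (1 - real k / real M) * un D e \<and>
        uk13 D k e = real k / real M * ut1 D e + 1 / real M * u13 D e
                     + (1 - real (k + 1) / real M) * un D e \<and>
        uk12 D k e = real k / real M * ut1 D e + 1 / real M * u12 D e
                     + (1 - real (k + 1) / real M) * un D e)"

definition fine_advancement ::
  "('c, 'e) mesh \<Rightarrow> ('c, 'e) lts \<Rightarrow> ('e, 'c, 'e) tendency \<Rightarrow> ('c, 'c, 'e) tendency \<Rightarrow>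
   real \<Rightarrow> nat \<Rightarrow> real \<Rightarrow> real \<Rightarrow> real \<Rightarrow> ('c, 'e) step_data \<Rightarrow> bool" where
  "fine_advancement G L \<Phi> \<Psi> dt M \<beta>1 \<beta>2 \<beta>3 D \<longleftrightarrow>
     (\<forall>i\<in>reg_cells G L Fine.
        hk D 0 i = hn D i \<and>
        (\<forall>k<M.
           hk13 D k i = hk D k i + dt / (3 * real M) * \<Psi> i (uk D k) (hk D k) \<and>
           hks D k i = \<beta>1 * hk13 D k i + (1 - \<beta>1) * hk D k i \<and>
           hk12 D k i = hk D k i + dt / (2 * real M) * \<Psi> i (uk13 D k) (hk13 D k) \<and>
           hkss D k i = \<beta>2 * hk12 D k i + (1 - \<beta>2) * hk D k i \<and>
           hk D (k + 1) i = hk D k i + dt / real M * \<Psi> i (uk12 D k) (hk12 D k) \<and>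
           hksss D k i = \<beta>3 * hk D (k + 1) i + (1 - 2 * \<beta>3) * hk12 D k i + \<beta>3 * hk D k i) \<and>
        hnew D i = hk D M i) \<and>
     (\<forall>e\<in>reg_edges G L Fine.
        uk D 0 e = un D e \<and>
        (\<forall>k<M.
           uk13 D k e = uk D k e + dt / (3 * real M) * \<Phi> e (uk D k) (hks D k) \<and>
           uk12 D k e = uk D k e + dt / (2 * real M) * \<Phi> e (uk13 D k) (hkss D k) \<and>
           uk D (k + 1) e = uk D k e + dt / real M * \<Phi> e (uk12 D k) (hksss D k)) \<and>
        unew D e = uk D M e)"

text \<open>
  The first two conjuncts extend the substep data at \<open>(n, k + 1/2)\<close> to \<open>IF2\<close> and
  \<open>Interior\<close> by the data of the coarse advancement, which do not depend on \<open>k\<close>.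
\<close>

definition interface_correction ::
  "('c, 'e) mesh \<Rightarrow> ('c, 'e) lts \<Rightarrow> ('e, 'c, 'e) tendency \<Rightarrow> ('c, 'c, 'e) tendency \<Rightarrow>
   real \<Rightarrow> nat \<Rightarrow> ('c, 'e) step_data \<Rightarrow> bool" where
  "interface_correction G L \<Phi> \<Psi> dt M D \<longleftrightarrow>
     (\<forall>i\<in>reg_cells G L IF2 \<union> reg_cells G L Interior. \<forall>k<M.
        hk12 D k i = h12 D i \<and> hksss D k i = hsss D i) \<and>
     (\<forall>e\<in>reg_edges G L IF2 \<union> reg_edges G L Interior. \<forall>k<M. uk12 D k e = u12 D e) \<and>
     (\<forall>i\<in>reg_cells G L IF1 \<union> reg_cells G L IF2.
        hnew D i = hn D i + dt / real M * (\<Sum>k<M. \<Psi> i (uk12 D k) (hk12 D k))) \<and>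
     (\<forall>e\<in>reg_edges G L IF1 \<union> reg_edges G L IF2.
        unew D e = un D e + dt / real M * (\<Sum>k<M. \<Phi> e (uk12 D k) (hksss D k)))"

definition fb_lts_step ::
  "('c, 'e) mesh \<Rightarrow> ('c, 'e) lts \<Rightarrow> ('e, 'c, 'e) tendency \<Rightarrow> ('c, 'c, 'e) tendency \<Rightarrow>
   real \<Rightarrow> nat \<Rightarrow> real \<Rightarrow> real \<Rightarrow> real \<Rightarrow> ('c, 'e) step_data \<Rightarrow> bool" where
  "fb_lts_step G L \<Phi> \<Psi> dt M \<beta>1 \<beta>2 \<beta>3 D \<longleftrightarrow>
     coarse_advancement G L \<Phi> \<Psi> dt \<beta>1 \<beta>2 \<beta>3 D \<and>
     interface_prediction G L M \<beta>1 \<beta>2 \<beta>3 D \<and>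
     fine_advancement G L \<Phi> \<Psi> dt M \<beta>1 \<beta>2 \<beta>3 D \<and>
     interface_correction G L \<Phi> \<Psi> dt M D"


section \<open>No-flow boundary conditions\<close>

text \<open>
  Every normal velocity computed in the step vanishes at the boundary edges, and at such an
  edge a vanishing normal velocity gives no thickness flux.
\<close>

definition no_flow ::
  "('c, 'e) mesh \<Rightarrow> ('c, 'e) lts \<Rightarrow> ('e \<Rightarrow> real \<Rightarrow> ('c \<Rightarrow> real) \<Rightarrow> real) \<Rightarrow> nat \<Rightarrow>
   ('c, 'e) step_data \<Rightarrow> bool" where
  "no_flow G L F M D \<longleftrightarrow>
     (\<forall>e\<in>boundary_edges G.
        (\<forall>h. F e 0 h = 0) \<and>
        un D e = 0 \<and> unew D e = 0 \<and>
        (e \<in> coarse_stage_edges G L 4 \<longrightarrow> u13 D e = 0) \<and>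
        (e \<in> coarse_stage_edges G L 2 \<longrightarrow> u12 D e = 0) \<and>
        (e \<in> reg_edges G L IF1 \<longrightarrow> ut1 D e = 0) \<and>
        (e \<in> reg_edges G L Fine \<union> reg_edges G L IF1 \<longrightarrow>
           (\<forall>k<M. uk D k e = 0 \<and> uk13 D k e = 0 \<and> uk12 D k e = 0)))"

end

theory Submission
  imports Defs
begin

text \<open>
  Mass is conserved because every cell, whatever its region, ends up being updated by one and
  the same family of substep fluxes: with the substep data at \<open>(n, k + 1/2)\<close>,
  \<open>h\<^sub>i\<^sup>n\<^sup>+\<^sup>1 = h\<^sub>i\<^sup>n + dt / M * (\<Sum>k<M. \<Psi>\<^sub>i k)\<close>
  (\<open>thickness_update_by_substep_fluxes\<close>).  On the fine cells this is the telescoped sum of the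
  substeps, and on the interface cells it is the correction, which is designed for this purpose.
  On an interior cell all \<open>M\<close> substep tendencies coincide with the single coarse tendency, since
  such a cell borders only \<open>IF2\<close> and \<open>Interior\<close>, where the substep data are frozen at the
  coarse values.

  It remains to see that the area-weighted tendencies of each substep add up to zero
  (\<open>total_thickness_tendency_eq_0\<close>).  After exchanging the sums over cells and edges, an
  edge shared by two cells contributes the same flux twice with opposite signs, and a boundary edge
  contributes nothing because its flux vanishes.  The exchange needs both neighbours of an edge to
  see the same flux, which is exactly what the common family of substep data provides.
\<close>

section \<open>Cancellation of fluxes\<close>

lemma orient_sum_eq_0:
  assumes "wf_mesh G" "e \<in> edges G" "card (edge_cells G e) = 2"
  shows "(\<Sum>i\<in>edge_cells G e. orient G e i) = 0"
proof -
  obtain i j where ij: "edge_cells G e = {i, j}" "i \<noteq> j"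
    using assms(3) by (meson card_2_iff)
  have "orient G e i = - orient G e j"
    using assms(1,2) ij unfolding wf_mesh_def by auto
  then show ?thesis using ij by simp
qed

text \<open>
  The divergence theorem for the flux form: summing over the cells leaves only the fluxes through
  the boundary edges.
\<close>

lemma total_thickness_tendency_eq_0:
  assumes wf: "wf_mesh G"
    and bdry: "\<And>e. e \<in> boundary_edges G \<Longrightarrow> F e (u e) h = 0"
  shows "(\<Sum>i\<in>cells G. area G i * thickness_tendency G F i u h) = 0"
proof -
  define f where "f e = len G e * F e (u e) h" for e
  have fin: "finite (cells G)" "finite (edges G)"
    and sub: "\<And>i. i \<in> cells G \<Longrightarrow> cell_edges G i \<subseteq> edges G"
    and area: "\<And>i. i \<in> cells G \<Longrightarrow> 0 < area G i"
    and card: "\<And>e. e \<in> edges G \<Longrightarrow> card (edge_cells G e) = 1 \<or> card (edge_cells G e) = 2"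
    using wf unfolding wf_mesh_def by auto
  have edge: "(\<Sum>i\<in>edge_cells G e. orient G e i * f e) = 0" if e: "e \<in> edges G" for e
  proof (cases "card (edge_cells G e) = 2")
    case True
    then show ?thesis
      using orient_sum_eq_0[OF wf e] by (simp flip: sum_distrib_right)
  next
    case False
    then have "e \<in> boundary_edges G" using card[OF e] e by (simp add: boundary_edges_def)
    then have "f e = 0" using bdry by (simp add: f_def)
    then show ?thesis by simp
  qed
  have "(\<Sum>i\<in>cells G. area G i * thickness_tendency G F i u h)
      = (\<Sum>i\<in>cells G. - (\<Sum>e\<in>cell_edges G i. orient G e i * f e))"
    using area by (intro sum.cong)
      (fastforce simp: thickness_tendency_def f_def mult.assoc)+
  also have "\<dots> = - (\<Sum>i\<in>cells G. \<Sum>e\<in>{e \<in> edges G. e \<in> cell_edges G i}. orient G e i * f e)"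
    unfolding sum_negf using sub by (intro arg_cong[where f = uminus] sum.cong) auto
  also have "\<dots> = - (\<Sum>e\<in>edges G. \<Sum>i\<in>edge_cells G e. orient G e i * f e)"
    unfolding edge_cells_def by (subst sum.swap_restrict[OF fin]) simp
  also have "\<dots> = 0" using edge by simp
  finally show ?thesis .
qed

lemma thickness_tendency_cong:
  assumes "local_flux G F" "cell_edges G i \<subseteq> edges G"
    and "\<And>e. e \<in> cell_edges G i \<Longrightarrow> u e = u' e"
    and "\<And>e j. e \<in> cell_edges G i \<Longrightarrow> j \<in> edge_cells G e \<Longrightarrow> h j = h' j"
  shows "thickness_tendency G F i u h = thickness_tendency G F i u' h'"
proof -
  have "F e (u e) h = F e (u' e) h'" if e: "e \<in> cell_edges G i" for e
  proof -
    have "e \<in> edges G" using assms(2) e by blast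
    then have "F e (u e) h = F e (u e) h'"
      using assms(1) assms(4)[OF e] unfolding local_flux_def by blast
    then show ?thesis using assms(3)[OF e] by simp
  qed
  then show ?thesis unfolding thickness_tendency_def by simp
qed

section \<open>Regions of neighbouring cells and edges\<close>

lemma region_of_neighbour_of_Interior:
  assumes "wf_lts G L" "i \<in> reg_cells G L Interior" "e \<in> cell_edges G i" "j \<in> edge_cells G e"
  shows "region L j = IF2 \<or> region L j = Interior"
proof -
  have "within_one (region L i) (region L j)"
    using assms unfolding wf_lts_def reg_cells_def edge_cells_def by blast
  then show ?thesis
    using assms(2) by (cases "region L j") (auto simp: within_one_def reg_cells_def)
qed

text \<open>
  A cell of least rank among those of the edge determines the edge's region.
\<close>

lemma edge_region_exists:
  assumes "e \<in> edges G" "edge_cells G e \<noteq> {}"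
  shows "\<exists>i\<in>edge_cells G e. e \<in> reg_edges G L (region L i)"
proof -
  obtain i where "i \<in> edge_cells G e" "\<forall>j\<in>edge_cells G e. rank (region L i) \<le> rank (region L j)"
    using assms(2) ex_has_least_nat[of "\<lambda>i. i \<in> edge_cells G e" _ "\<lambda>i. rank (region L i)"]
    by blast
  then show ?thesis using assms(1) unfolding reg_edges_def by blast
qed

text \<open>
  Being assigned to the region of one of its cells, such an edge inherits the restriction on the
  regions of the cell's neighbours.
\<close>

lemma edge_of_Interior_cell:
  assumes "wf_mesh G" "wf_lts G L" "i \<in> reg_cells G L Interior" "e \<in> cell_edges G i"
  shows "e \<in> reg_edges G L IF2 \<union> reg_edges G L Interior"
proof -
  have "e \<in> edges G" "edge_cells G e \<noteq> {}"
    using assms(1,3,4) unfolding wf_mesh_def reg_cells_def edge_cells_def by auto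
  from edge_region_exists[OF this, of L]
  obtain j where "j \<in> edge_cells G e" "e \<in> reg_edges G L (region L j)" ..
  then show ?thesis using region_of_neighbour_of_Interior[OF assms(2-4)] by fastforce
qed

section \<open>The common form of the thickness update\<close>

lemma Interior_tendency_substep:
  assumes "wf_mesh G" "wf_lts G L" "local_flux G F"
    and corr: "interface_correction G L \<Phi> \<Psi> dt M D"
    and i: "i \<in> reg_cells G L Interior" and k: "k < M"
  shows "thickness_tendency G F i (uk12 D k) (hk12 D k)
       = thickness_tendency G F i (u12 D) (h12 D)"
proof (rule thickness_tendency_cong[OF assms(3)])
  show "cell_edges G i \<subseteq> edges G"
    using assms(1) i unfolding wf_mesh_def reg_cells_def by auto
next
  fix e assume "e \<in> cell_edges G i"
  then show "uk12 D k e = u12 D e"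
    using edge_of_Interior_cell[OF assms(1,2) i] corr k unfolding interface_correction_def by blast
next
  fix e j assume "e \<in> cell_edges G i" "j \<in> edge_cells G e"
  then have "j \<in> reg_cells G L IF2 \<union> reg_cells G L Interior"
    using region_of_neighbour_of_Interior[OF assms(2) i] by (auto simp: reg_cells_def edge_cells_def)
  then show "hk12 D k j = h12 D j" using corr k unfolding interface_correction_def by blast
qed

lemma fine_substeps_telescope:
  assumes fine: "fine_advancement G L \<Phi> \<Psi> dt M \<beta>1 \<beta>2 \<beta>3 D"
    and i: "i \<in> reg_cells G L Fine"
  shows "hnew D i = hn D i + dt / real M * (\<Sum>k<M. \<Psi> i (uk12 D k) (hk12 D k))"
proof -
  have h0: "hk D 0 i = hn D i" and hM: "hnew D i = hk D M i"
    and step: "\<And>k. k < M \<Longrightarrow>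
      hk D (k + 1) i = hk D k i + dt / real M * \<Psi> i (uk12 D k) (hk12 D k)"
    using fine i unfolding fine_advancement_def by blast+
  have "hk D m i = hn D i + dt / real M * (\<Sum>k<m. \<Psi> i (uk12 D k) (hk12 D k))" if "m \<le> M" for m
    using that by (induction m) (use h0 step in \<open>auto simp: algebra_simps\<close>)
  then show ?thesis using hM by simp
qed

lemma thickness_update_by_substep_fluxes:
  assumes "wf_mesh G" "wf_lts G L" "local_flux G F" "1 \<le> M"
    and step: "fb_lts_step G L \<Phi> (thickness_tendency G F) dt M \<beta>1 \<beta>2 \<beta>3 D"
    and i: "i \<in> cells G"
  shows "hnew D i = hn D i + dt / real M *
    (\<Sum>k<M. thickness_tendency G F i (uk12 D k) (hk12 D k))"
proof -
  let ?\<Psi> = "thickness_tendency G F"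
  have coarse: "coarse_advancement G L \<Phi> ?\<Psi> dt \<beta>1 \<beta>2 \<beta>3 D"
    and fine: "fine_advancement G L \<Phi> ?\<Psi> dt M \<beta>1 \<beta>2 \<beta>3 D"
    and corr: "interface_correction G L \<Phi> ?\<Psi> dt M D"
    using step unfolding fb_lts_step_def by auto
  have reg: "i \<in> reg_cells G L (region L i)" using i by (simp add: reg_cells_def)
  show ?thesis
  proof (cases "region L i")
    case Fine
    then show ?thesis using fine_substeps_telescope[OF fine] reg by simp
  next
    case IF1
    then show ?thesis using corr reg unfolding interface_correction_def by auto
  next
    case IF2
    then show ?thesis using corr reg unfolding interface_correction_def by auto
  next
    case Interior
    then have "hnew D i = hn D i + dt * ?\<Psi> i (u12 D) (h12 D)"
      using coarse reg unfolding coarse_advancement_def by auto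
    moreover have "(\<Sum>k<M. ?\<Psi> i (uk12 D k) (hk12 D k)) = real M * ?\<Psi> i (u12 D) (h12 D)"
      using Interior_tendency_substep[OF assms(1-3) corr] reg Interior by simp
    ultimately show ?thesis using \<open>1 \<le> M\<close> by simp
  qed
qed

section \<open>Conservation of mass\<close>

text \<open>
  In the coarse regions without predicted data, the substep velocity is the coarse one at
  \<open>n + 1/2\<close>, so its vanishing is inherited from the coarse advancement.
\<close>

lemma no_flow_substep_velocity:
  assumes nf: "no_flow G L F M D"
    and corr: "interface_correction G L \<Phi> \<Psi> dt M D"
    and e: "e \<in> boundary_edges G" and k: "k < M"
  shows "uk12 D k e = 0"
proof -
  have "e \<in> edges G" "edge_cells G e \<noteq> {}" using e by (auto simp: boundary_edges_def)
  from edge_region_exists[OF this, of L] obtain R where R: "e \<in> reg_edges G L R" by blast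
  show ?thesis
  proof (cases "R = Fine \<or> R = IF1")
    case True
    then show ?thesis using nf e k R unfolding no_flow_def by blast
  next
    case False
    then have eR: "e \<in> reg_edges G L IF2 \<union> reg_edges G L Interior" using R by (cases R) auto
    then have "e \<in> coarse_stage_edges G L 2" by (auto simp: coarse_stage_edges_def)
    then have "u12 D e = 0" using nf e unfolding no_flow_def by blast
    then show ?thesis using corr eR k unfolding interface_correction_def by auto
  qed
qed

theorem theorem1:
  fixes G :: "('c, 'e) mesh"
    and L :: "('c, 'e) lts"
    and \<Phi> :: "'e \<Rightarrow> ('e \<Rightarrow> real) \<Rightarrow> ('c \<Rightarrow> real) \<Rightarrow> real"
    and F :: "'e \<Rightarrow> real \<Rightarrow> ('c \<Rightarrow> real) \<Rightarrow> real"
    and dt \<beta>1 \<beta>2 \<beta>3 :: real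
    and M :: nat
    and D :: "('c, 'e) step_data"
  assumes "wf_mesh G"
    and "wf_lts G L"
    and "local_momentum G L \<Phi>"
    and "local_flux G F"
    and "1 \<le> M"
    and "fb_lts_step G L \<Phi> (thickness_tendency G F) dt M \<beta>1 \<beta>2 \<beta>3 D"
    and "no_boundary G \<or> no_flow G L F M D"
  shows "(\<Sum>i\<in>cells G. area G i * hnew D i) = (\<Sum>i\<in>cells G. area G i * hn D i)"
proof -
  let ?\<Psi> = "thickness_tendency G F"
  have corr: "interface_correction G L \<Phi> ?\<Psi> dt M D"
    using assms(6) unfolding fb_lts_step_def by auto
  have bdry: "F e (uk12 D k e) (hk12 D k) = 0" if "e \<in> boundary_edges G" "k < M" for e k
    using assms(7)
  proof
    assume "no_boundary G"
    then show ?thesis using that by (auto simp: no_boundary_def boundary_edges_def)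
  next
    assume nf: "no_flow G L F M D"
    then show ?thesis
      using no_flow_substep_velocity[OF nf corr that] that unfolding no_flow_def by auto
  qed
  have "(\<Sum>i\<in>cells G. area G i * hnew D i)
      = (\<Sum>i\<in>cells G. area G i * hn D i
          + dt / real M * (\<Sum>k<M. area G i * ?\<Psi> i (uk12 D k) (hk12 D k)))"
    using thickness_update_by_substep_fluxes[OF assms(1,2,4-6)]
    by (intro sum.cong) (simp_all add: distrib_left flip: sum_distrib_left)
  also have "\<dots> = (\<Sum>i\<in>cells G. area G i * hn D i)
      + dt / real M * (\<Sum>k<M. \<Sum>i\<in>cells G. area G i * ?\<Psi> i (uk12 D k) (hk12 D k))"
    by (subst sum.swap) (simp add: sum.distrib sum_distrib_left)
  also have "\<dots> = (\<Sum>i\<in>cells G. area G i * hn D i)"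
    using total_thickness_tendency_eq_0[OF assms(1)] bdry by simp
  finally show ?thesis .
qed

end
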